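(* Let $L(\lambda)=\lambda M+K\in\mathbb{C}^{2n\times2n}[\lambda]$ be a regular $*$-skew-Hamiltonian/Hamiltonian ($*$-SHH) pencil. Let $(X_c,\Lambda_c)$ and $(X_f,\Lambda_f)$ be complementary deflating pairs of $L(\lambda)$, where $$\Lambda_c=\mathrm{diag}(\lambda_1^c,-\overline{\lambda_1^c},\dots,\lambda_m^c,-\overline{\lambda_m^c},\lambda_{m+1}^c,\dots,\lambda_p^c),$$ $\mathrm{re}(\lambda_j^c)\ne0$ for $j=1,\dots,m$, and $\lambda_k^c$ is purely imaginary for $k=m+1,\dots,p$. Let $$\Lambda_a=\mathrm{diag}(\lambda_1^a,-\overline{\lambda_1^a},\dots,\lambda_m^a,-\overline{\lambda_m^a},\lambda_{m+1}^a,\dots,\lambda_p^a),$$ where $\mathrm{re}(\lambda_j^a)\ne0$ for $j=1,\dots,m$ and $\lambda_k^a$ is purely imaginary for $k=m+1,\dots,p$. Suppose that (a) $\sigma(\Lambda_c)\cap\sigma(-\Lambda_f^* )=\emptyset$, (b) $G:=X_c^*JMX_c$ is nonsingular, and that the $\lambda_i^c$ are simple eigenvalues of $L(\lambda)$. Put $U:=JMX_cG^{-1}$, $H_a=(\Lambda_a^*\Lambda_a+I_{m+p})^{-1}$, and $$\hat M=G(\Lambda_c-\Lambda_a)H_a\Lambda_a^*+Z_1(I_{m+p}-\Lambda_aH_a\Lambda_a^* )-Z_2H_a\Lambda_a^*,$$ $$\hat K=G(\Lambda_c-\Lambda_a)H_a-Z_1\Lambda_aH_a+Z_2(I_{m+p}-H_a),$$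 where $Z_i=\mathrm{diag}(Z_1^{(i)},\dots,Z_m^{(i)},z_{m+1}^{(i)},\dots,z_p^{(i)})$, $i=1,2$, with $$Z_j^{(1)}=\begin{bmatrix}0&\alpha_j\\-\overline{\alpha_j}&0\end{bmatrix},\qquad Z_j^{(2)}=\begin{bmatrix}0&\beta_j\\\overline{\beta_j}&0\end{bmatrix},\qquad \alpha_j,\beta_j\in\mathbb{C},\ 1\le j\le m,$$ $z_k^{(1)}$ purely imaginary and $z_k^{(2)}$ real for $m+1\le k\le p$. Then for $\Delta M=J^TU\hat MU^*$ and $\Delta K=J^TU\hat KU^*$ the pairs $(X_c,\Lambda_a)$ and $(X_f,\Lambda_f)$ are complementary deflating pairs of $L_\Delta(\lambda)=\lambda(M+\Delta M)+(K+\Delta K)$. Besides, $\Delta M$ is $*$-skew-Hamiltonian and $\Delta K$ is $*$-Hamiltonian.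
   Context: $J=\begin{bmatrix}0&I_n\\-I_n&0\end{bmatrix}$; $*$ denotes conjugate transpose. A matrix $A\in\mathbb{C}^{2n\times2n}$ is $*$-skew-Hamiltonian if $(JA)^*=-JA$ and $*$-Hamiltonian if $(JA)^*=JA$. A pencil $\lambda M+K$ is $*$-SHH if $M$ is $*$-skew-Hamiltonian and $K$ is $*$-Hamiltonian; it is regular if $\det(\lambda M+K)$ is not the zero polynomial. A deflating pair of a pencil $\lambda M+K\in\mathbb{C}^{N\times N}[\lambda]$ is a matrix pair $(X,\Lambda)\in\mathbb{C}^{N\times q}\times\mathbb{C}^{q\times q}$ with $\operatorname{rank}X=q\le N$ and $MX\Lambda+KX=0$. Two deflating pairs $(X_1,\Lambda_1)$, $(X_2,\Lambda_2)$ are complementary if $[X_1\ X_2]$ is a nonsingular square matrix. $\sigma(\Lambda)$ is the spectrum of $\Lambda$. *)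

theory Defs
  imports
    "Jordan_Normal_Form.Spectral_Radius"
    "Jordan_Normal_Form.DL_Rank"
begin

definition J_mat :: "nat \<Rightarrow> complex mat" where
  "J_mat n = four_block_mat (0\<^sub>m n n) (1\<^sub>m n) (- 1\<^sub>m n) (0\<^sub>m n n)"

definition star_skew_Hamiltonian :: "nat \<Rightarrow> complex mat \<Rightarrow> bool" where
  "star_skew_Hamiltonian n A \<longleftrightarrow>
     A \<in> carrier_mat (2 * n) (2 * n) \<and> mat_adjoint (J_mat n * A) = - (J_mat n * A)"

definition star_Hamiltonian :: "nat \<Rightarrow> complex mat \<Rightarrow> bool" where
  "star_Hamiltonian n A \<longleftrightarrow>
     A \<in> carrier_mat (2 * n) (2 * n) \<and> mat_adjoint (J_mat n * A) = J_mat n * A"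

text \<open>A pencil \<open>\<lambda>M + K\<close> is represented by its two coefficient matrices.\<close>

definition star_SHH :: "nat \<Rightarrow> complex mat \<Rightarrow> complex mat \<Rightarrow> bool" where
  "star_SHH n M K \<longleftrightarrow> star_skew_Hamiltonian n M \<and> star_Hamiltonian n K"

definition pencil_det :: "complex mat \<Rightarrow> complex mat \<Rightarrow> complex poly" where
  "pencil_det M K =
     det ([:0, 1:] \<cdot>\<^sub>m map_mat (\<lambda>a. [:a:]) M + map_mat (\<lambda>a. [:a:]) K)"

lemma poly_pencil_det:
  assumes "M \<in> carrier_mat N N" "K \<in> carrier_mat N N"
  shows "poly (pencil_det M K) z = det (z \<cdot>\<^sub>m M + K)"
proof -
  have ev: "comm_ring_hom (\<lambda>p :: complex poly. poly p z)"
    by unfold_locales auto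
  have "map_mat (\<lambda>p. poly p z)
          ([:0, 1:] \<cdot>\<^sub>m map_mat (\<lambda>a. [:a:]) M + map_mat (\<lambda>a. [:a:]) K) = z \<cdot>\<^sub>m M + K"
    using assms by (intro eq_matI) auto
  then show ?thesis
    unfolding pencil_det_def by (metis comm_ring_hom.hom_det[OF ev])
qed

definition regular_pencil :: "complex mat \<Rightarrow> complex mat \<Rightarrow> bool" where
  "regular_pencil M K \<longleftrightarrow> pencil_det M K \<noteq> 0"

definition simple_eigenvalue :: "complex mat \<Rightarrow> complex mat \<Rightarrow> complex \<Rightarrow> bool" where
  "simple_eigenvalue M K \<mu> \<longleftrightarrow>
     regular_pencil M K \<and> Polynomial.order \<mu> (pencil_det M K) = 1"

definition deflating_pair ::
    "nat \<Rightarrow> nat \<Rightarrow> complex mat \<Rightarrow> complex mat \<Rightarrow> complex mat \<Rightarrow> complex mat \<Rightarrow> bool" where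
  "deflating_pair N q M K X \<Lambda> \<longleftrightarrow>
     X \<in> carrier_mat N q \<and> \<Lambda> \<in> carrier_mat q q \<and> q \<le> N \<and> vec_space.rank N X = q \<and>
     M * X * \<Lambda> + K * X = 0\<^sub>m N q"

definition hconcat :: "complex mat \<Rightarrow> complex mat \<Rightarrow> complex mat" where
  "hconcat A B = four_block_mat A B (0\<^sub>m 0 (dim_col A)) (0\<^sub>m 0 (dim_col B))"

definition complementary_deflating_pairs ::
    "nat \<Rightarrow> nat \<Rightarrow> nat \<Rightarrow> complex mat \<Rightarrow> complex mat \<Rightarrow>
     complex mat \<Rightarrow> complex mat \<Rightarrow> complex mat \<Rightarrow> complex mat \<Rightarrow> bool" where
  "complementary_deflating_pairs N q\<^sub>1 q\<^sub>2 M K X\<^sub>1 \<Lambda>\<^sub>1 X\<^sub>2 \<Lambda>\<^sub>2 \<longleftrightarrow>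
     deflating_pair N q\<^sub>1 M K X\<^sub>1 \<Lambda>\<^sub>1 \<and> deflating_pair N q\<^sub>2 M K X\<^sub>2 \<Lambda>\<^sub>2 \<and>
     invertible_mat (hconcat X\<^sub>1 X\<^sub>2)"

text \<open>Only meaningful for invertible matrices.\<close>

definition minv :: "complex mat \<Rightarrow> complex mat" where
  "minv A = the (mat_inverse A)"

text \<open>Block diagonal matrix of size \<open>m + p\<close> (for \<open>m \<le> p\<close>) with the \<open>2 \<times> 2\<close> blocks
  \<open>B 1, \<dots>, B m\<close> followed by the scalars \<open>d (m + 1), \<dots>, d p\<close>; indices start at \<open>1\<close>.\<close>

definition paired_diag :: "nat \<Rightarrow> nat \<Rightarrow> (nat \<Rightarrow> complex mat) \<Rightarrow> (nat \<Rightarrow> complex) \<Rightarrow> complex mat" where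
  "paired_diag m p B d =
     diag_block_mat (map B [1..<Suc m] @ map (\<lambda>k. mat_of_rows_list 1 [[d k]]) [Suc m..<Suc p])"

definition eigenvalue_diag :: "nat \<Rightarrow> nat \<Rightarrow> (nat \<Rightarrow> complex) \<Rightarrow> complex mat" where
  "eigenvalue_diag m p l =
     paired_diag m p (\<lambda>j. mat_of_rows_list 2 [[l j, 0], [0, - cnj (l j)]]) l"

end

theory Submission
  imports Defs
begin

text \<open>Put \<open>S = J M\<close> and \<open>T = J K\<close>, so \<open>S\<^sup>* = - S\<close> and \<open>T\<^sup>* = T\<close>.  Multiplying the perturbed
  pencil by \<open>J\<close> turns it into \<open>\<lambda>(S + U M_hat U\<^sup>*) + (T + U K_hat U\<^sup>*)\<close>, so everything comes down to
  two facts about \<open>U\<close> and three about the small matrices \<open>M_hat\<close>, \<open>K_hat\<close>.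

  The matrix \<open>U\<close> is dual to the two deflating subspaces: \<open>U\<^sup>* X\<^sub>c = I\<close>, since \<open>G\<close> is skew-Hermitian,
  and \<open>U\<^sup>* X\<^sub>f = 0\<close>.  For the latter, \<open>Y = X\<^sub>c\<^sup>* S X\<^sub>f\<close> satisfies the Sylvester equation
  \<open>Y \<Lambda>\<^sub>f = - \<Lambda>\<^sub>c\<^sup>* Y\<close>, whose only solution is zero because the spectra of \<open>\<Lambda>\<^sub>c\<close> and \<open>- \<Lambda>\<^sub>f\<^sup>*\<close> are
  disjoint (\<open>sylvester_diag_trivial\<close>).  Hence the perturbation does not touch \<open>X\<^sub>f\<close>, while on \<open>X\<^sub>c\<close> it
  replaces \<open>\<Lambda>\<^sub>c\<close> by \<open>\<Lambda>\<^sub>a\<close> as soon as \<open>M_hat \<Lambda>\<^sub>a + K_hat = G (\<Lambda>\<^sub>c - \<Lambda>\<^sub>a)\<close>; it has the required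
  symmetry as soon as \<open>M_hat\<close> is skew-Hermitian and \<open>K_hat\<close> is Hermitian.  This reduction is
  \<open>structured_perturbation\<close>.

  The equation for \<open>M_hat\<close> and \<open>K_hat\<close> is an identity in which \<open>H\<^sub>a (\<Lambda>\<^sub>a\<^sup>* \<Lambda>\<^sub>a + I) = I\<close> cancels the
  free parameters \<open>Z\<^sub>1\<close>, \<open>Z\<^sub>2\<close>.  Their symmetry needs that the entry \<open>(i, j)\<close> of each of
  \<open>G\<close>, \<open>Z\<^sub>1\<close>, \<open>Z\<^sub>2\<close> vanishes unless the \<open>j\<close>-th entries of \<open>\<Lambda>\<^sub>c\<close> and of \<open>\<Lambda>\<^sub>a\<close> are the negative
  conjugates of the \<open>i\<close>-th ones (\<open>hat_matrices\<close>).  For \<open>Z\<^sub>1\<close>, \<open>Z\<^sub>2\<close> this is built into the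
  block pattern.  For \<open>G\<close>, the matrix \<open>G \<Lambda>\<^sub>c = - X\<^sub>c\<^sup>* T X\<^sub>c\<close> is Hermitian, so \<open>G\<close> can only be nonzero at
  \<open>(i, j)\<close> if the entries of \<open>\<Lambda>\<^sub>c\<close> are related in that way (\<open>deflating_gram_matrix\<close>); to carry
  the relation over to \<open>\<Lambda>\<^sub>a\<close> one needs \<open>j\<close> to be the partner of \<open>i\<close> in the block pattern, hence that
  the diagonal entries of \<open>\<Lambda>\<^sub>c\<close> are pairwise distinct.  That is where simplicity enters
  (\<open>paired_entries_inj\<close>): the determinant of the pencil is a constant multiple of the product of
  the characteristic polynomials of \<open>\<Lambda>\<^sub>c\<close> and \<open>\<Lambda>\<^sub>f\<close>, so a repeated entry is a multiple root.\<close>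

section \<open>Adjoints, diagonal matrices and inverses\<close>

lemma mat_adjoint_carrier [simp]:
  "A \<in> carrier_mat nr nc \<Longrightarrow> mat_adjoint A \<in> carrier_mat nc nr"
  by (auto simp: mat_adjoint_def mat_of_rows_def)

lemma mat_adjoint_index [simp]:
  fixes A :: "complex mat"
  assumes "i < dim_col A" "j < dim_row A"
  shows "mat_adjoint A $$ (i, j) = cnj (A $$ (j, i))"
  using assms by (auto simp: mat_adjoint_def mat_of_rows_def conjugate_vec_def)

lemma mat_adjoint_dim [simp]:
  "dim_row (mat_adjoint A) = dim_col A" "dim_col (mat_adjoint A) = dim_row A"
  by (auto simp: mat_adjoint_def mat_of_rows_def)

lemma mat_adjoint_mult:
  fixes A B :: "complex mat"
  assumes "A \<in> carrier_mat nr k" "B \<in> carrier_mat k nc"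
  shows "mat_adjoint (A * B) = mat_adjoint B * mat_adjoint A"
  using assms by (intro eq_matI) (auto simp: scalar_prod_def mult.commute)

lemma mat_adjoint_uminus: "mat_adjoint (- A) = - mat_adjoint (A :: complex mat)"
  by (intro eq_matI) auto

lemma mat_adjoint_adjoint [simp]: "mat_adjoint (mat_adjoint A) = (A :: complex mat)"
  by (intro eq_matI) auto

lemma mat_adjoint_one [simp]: "mat_adjoint (1\<^sub>m k) = (1\<^sub>m k :: complex mat)"
  by (intro eq_matI) auto

lemma mat_diag_dims [simp]: "dim_row (mat_diag k f) = k" "dim_col (mat_diag k f) = k"
  by (simp_all add: mat_diag_def)

lemma mat_adjoint_mat_diag: "mat_adjoint (mat_diag k f) = mat_diag k (\<lambda>i. cnj (f i))"
  by (intro eq_matI) (auto simp: mat_diag_def)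

lemma minv_inverse:
  assumes "A \<in> carrier_mat k k" "invertible_mat A"
  shows "A * minv A = 1\<^sub>m k" "minv A * A = 1\<^sub>m k" "minv A \<in> carrier_mat k k"
proof -
  obtain B where B: "A * B = 1\<^sub>m (dim_row A)" "B * A = 1\<^sub>m (dim_row B)"
    using assms(2) unfolding invertible_mat_def inverts_mat_def by auto
  have "dim_row B = k" "dim_col B = k"
    using assms(1) B by (metis carrier_matD(2) index_mult_mat(3) index_one_mat(3),
        metis assms(1) B(1) carrier_matD(1) index_mult_mat(3) index_one_mat(3))
  then have "B \<in> carrier_mat k k" by auto
  then have "A \<in> Units (ring_mat TYPE(complex) k ())"
    using B assms(1) unfolding Units_def ring_mat_def by (auto intro!: bexI[of _ B])
  then obtain C where "mat_inverse A = Some C"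
    using mat_inverse(1)[OF assms(1)] by fastforce
  then show "A * minv A = 1\<^sub>m k" "minv A * A = 1\<^sub>m k" "minv A \<in> carrier_mat k k"
    using mat_inverse(2)[OF assms(1)] by (auto simp: minv_def)
qed

lemma minv_mat_diag:
  assumes "\<And>i. i < k \<Longrightarrow> f i \<noteq> 0"
  shows "minv (mat_diag k f) = mat_diag k (\<lambda>i. inverse (f i))"
proof -
  have one: "mat_diag k f * mat_diag k (\<lambda>i. inverse (f i)) = 1\<^sub>m k"
    "mat_diag k (\<lambda>i. inverse (f i)) * mat_diag k f = 1\<^sub>m k"
    using assms by (simp_all add: mat_diag_diag) (auto simp: mat_diag_def intro!: eq_matI)
  have "invertible_mat (mat_diag k f)"
    unfolding invertible_mat_def inverts_mat_def
    using one by (auto intro!: exI[of _ "mat_diag k (\<lambda>i. inverse (f i))"] simp: mat_diag_def)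
  note inv = minv_inverse[OF mat_diag_dim this]
  have "minv (mat_diag k f) = minv (mat_diag k f) * (mat_diag k f * mat_diag k (\<lambda>i. inverse (f i)))"
    using inv one by simp
  also have "\<dots> = mat_diag k (\<lambda>i. inverse (f i))"
    using inv by (simp add: assoc_mult_mat[of _ k k _ k _ k, symmetric] left_mult_one_mat[OF mat_diag_dim]
        del: mat_diag_diag assoc_mult_mat)
  finally show ?thesis .
qed

lemma index_mult_mat_diag:
  "A \<in> carrier_mat nr k \<Longrightarrow> i < nr \<Longrightarrow> j < k \<Longrightarrow> (A * mat_diag k f) $$ (i, j) = A $$ (i, j) * f j"
  by (subst mat_diag_mult_right) auto

lemma mult_mat_diag_mult_mat_diag:
  "A \<in> carrier_mat nr k \<Longrightarrow> A * mat_diag k f * mat_diag k g = A * mat_diag k (\<lambda>i. f i * g i)"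
  by (subst assoc_mult_mat[of _ nr k _ k _ k]) auto

section \<open>Repeated eigenvalues of a pencil\<close>

lemma hconcat_carrier [simp]:
  "X \<in> carrier_mat N r \<Longrightarrow> Y \<in> carrier_mat N q \<Longrightarrow> hconcat X Y \<in> carrier_mat N (r + q)"
  by (auto simp: hconcat_def)

lemma mult_hconcat:
  assumes "A \<in> carrier_mat k N" "X \<in> carrier_mat N r" "Y \<in> carrier_mat N q"
  shows "A * hconcat X Y = hconcat (A * X) (A * Y)"
  using assms by (intro eq_matI) (auto simp: hconcat_def scalar_prod_def)

lemma hconcat_mult_block_diag:
  assumes "X \<in> carrier_mat N r" "Y \<in> carrier_mat N q" "A \<in> carrier_mat r r" "B \<in> carrier_mat q q"
  shows "hconcat X Y * four_block_mat A (0\<^sub>m r q) (0\<^sub>m q r) B = hconcat (X * A) (Y * B)"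
proof -
  have "hconcat X Y * four_block_mat A (0\<^sub>m r q) (0\<^sub>m q r) B =
    four_block_mat (X * A + Y * 0\<^sub>m q r) (X * 0\<^sub>m r q + Y * B)
      (0\<^sub>m 0 r * A + 0\<^sub>m 0 q * 0\<^sub>m q r) (0\<^sub>m 0 r * 0\<^sub>m r q + 0\<^sub>m 0 q * B)"
    using assms unfolding hconcat_def
    by (subst mult_four_block_mat[of _ N r _ q _ 0 _ _ r _ q]) auto
  then show ?thesis
    using assms by (simp add: hconcat_def)
qed

text \<open>
  Each deflating pair gives \<open>(z M + K) X = M X (z I - L)\<close>, because \<open>K X = - M X L\<close>; the two
  identities sit side by side.
\<close>

lemma pencil_mult_hconcat:
  assumes M: "M \<in> carrier_mat N N" and K: "K \<in> carrier_mat N N"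
    and D1: "deflating_pair N r M K X1 L1" and D2: "deflating_pair N q M K X2 L2"
    and N: "N = r + q"
  shows "(z \<cdot>\<^sub>m M + K) * hconcat X1 X2 =
    (M * hconcat X1 X2) * four_block_mat (z \<cdot>\<^sub>m 1\<^sub>m r - L1) (0\<^sub>m r q) (0\<^sub>m q r) (z \<cdot>\<^sub>m 1\<^sub>m q - L2)"
proof -
  have c: "X1 \<in> carrier_mat N r" "L1 \<in> carrier_mat r r" "X2 \<in> carrier_mat N q" "L2 \<in> carrier_mat q q"
    using D1 D2 by (auto simp: deflating_pair_def)
  have step: "(z \<cdot>\<^sub>m M + K) * X = M * (X * (z \<cdot>\<^sub>m 1\<^sub>m r - L))"
    if d: "deflating_pair N r M K X L" for r X L
  proof -
    have c: "X \<in> carrier_mat N r" "L \<in> carrier_mat r r" and e: "M * X * L + K * X = 0\<^sub>m N r"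
      using d by (auto simp: deflating_pair_def)
    have "K * X = - (M * X * L)"
    proof (rule eq_matI)
      fix i j assume ij: "i < dim_row (- (M * X * L))" "j < dim_col (- (M * X * L))"
      then have "(M * X * L + K * X) $$ (i, j) = 0" using e c M K by auto
      then show "(K * X) $$ (i, j) = (- (M * X * L)) $$ (i, j)"
        using ij c M K by (auto simp del: index_mult_mat(1) simp: add_eq_0_iff)
    qed (use c M K in auto)
    moreover have "z \<cdot>\<^sub>m (M * X) + - (M * X * L) = z \<cdot>\<^sub>m (M * X) - M * X * L"
      using c M by (intro add_uminus_minus_mat[of _ N r]) auto
    ultimately have "(z \<cdot>\<^sub>m M + K) * X = z \<cdot>\<^sub>m (M * X) - M * X * L"
      using c M K by (simp add: add_mult_distrib_mat[of _ N N] mult_smult_assoc_mat[of M N N X r]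
          del: assoc_mult_mat)
    also have "\<dots> = M * X * (z \<cdot>\<^sub>m 1\<^sub>m r - L)"
      using c M K by (subst mult_minus_distrib_mat[of _ N r _ r])
        (auto simp: mult_smult_distrib[of _ N r _ r] simp del: assoc_mult_mat)
    finally show ?thesis
      using assoc_mult_mat[OF M c(1) minus_carrier_mat[OF c(2)]] by simp
  qed
  have "(z \<cdot>\<^sub>m M + K) * hconcat X1 X2 = M * hconcat (X1 * (z \<cdot>\<^sub>m 1\<^sub>m r - L1)) (X2 * (z \<cdot>\<^sub>m 1\<^sub>m q - L2))"
    using c M K step[OF D1] step[OF D2]
    by (subst (1 2) mult_hconcat[of _ N N]) (auto simp: mult_hconcat[of _ N N _ r _ q])
  also have "\<dots> = M * (hconcat X1 X2 *
      four_block_mat (z \<cdot>\<^sub>m 1\<^sub>m r - L1) (0\<^sub>m r q) (0\<^sub>m q r) (z \<cdot>\<^sub>m 1\<^sub>m q - L2))"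
    using c by (subst hconcat_mult_block_diag[of _ N r _ q]) auto
  also have "\<dots> = (M * hconcat X1 X2) *
      four_block_mat (z \<cdot>\<^sub>m 1\<^sub>m r - L1) (0\<^sub>m r q) (0\<^sub>m q r) (z \<cdot>\<^sub>m 1\<^sub>m q - L2)"
    using c M N by (intro assoc_mult_mat[symmetric, of _ N N _ N _ N]) auto
  finally show ?thesis .
qed

text \<open>
  Taking determinants in \<open>pencil_mult_hconcat\<close> shows that the pencil determinant is, up to a
  nonzero constant, \<open>\<Prod>(z - \<mu> i)\<close> times the characteristic polynomial of \<open>L2\<close> times the
  determinant of \<open>M [X1 X2]\<close>.  Two equal \<open>\<mu>\<close>'s therefore produce a double root.
\<close>

lemma repeated_entry_not_simple:
  assumes M: "M \<in> carrier_mat N N" and K: "K \<in> carrier_mat N N"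
    and compl: "complementary_deflating_pairs N r q M K X1 (mat_diag r \<mu>) X2 L2"
    and ab: "a < r" "b < r" "a \<noteq> b" "\<mu> a = \<mu> b"
  shows "\<not> simple_eigenvalue M K (\<mu> a)"
proof
  assume simple: "simple_eigenvalue M K (\<mu> a)"
  let ?X = "hconcat X1 X2"
  have D: "deflating_pair N r M K X1 (mat_diag r \<mu>)" "deflating_pair N q M K X2 L2"
    and inv: "invertible_mat ?X"
    using compl by (auto simp: complementary_deflating_pairs_def)
  have c: "X1 \<in> carrier_mat N r" "X2 \<in> carrier_mat N q" "L2 \<in> carrier_mat q q"
    using D by (auto simp: deflating_pair_def)
  have X: "?X \<in> carrier_mat N (r + q)" using c by simp
  have N: "N = r + q"
    using inv X unfolding invertible_mat_def square_mat.simps by auto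
  have X': "?X \<in> carrier_mat N N" using X N by simp
  have "det ?X * det (minv ?X) = 1"
    using minv_inverse[OF X' inv] det_mult[OF X', of "minv ?X"] by simp
  then have detX: "det ?X \<noteq> 0" by auto
  have det1: "det (z \<cdot>\<^sub>m 1\<^sub>m r - mat_diag r \<mu>) = (\<Prod>i<r. z - \<mu> i)" for z
  proof -
    have e: "z \<cdot>\<^sub>m 1\<^sub>m r - mat_diag r \<mu> = mat_diag r (\<lambda>i. z - \<mu> i)"
      by (intro eq_matI) (auto simp: mat_diag_def)
    have "det (mat_diag r (\<lambda>i. z - \<mu> i)) = prod_list (diag_mat (mat_diag r (\<lambda>i. z - \<mu> i)))"
      by (rule det_upper_triangular[of _ r]) (auto simp: mat_diag_def)
    also have "\<dots> = (\<Prod>i<r. z - \<mu> i)"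
      by (simp add: diag_mat_def mat_diag_def prod.list_conv_set_nth atLeast0LessThan)
    finally show ?thesis using e by simp
  qed
  have det2: "det (z \<cdot>\<^sub>m 1\<^sub>m q - L2) = poly (char_poly L2) z" for z
  proof -
    have "z \<cdot>\<^sub>m 1\<^sub>m q - L2 = - (char_matrix L2 z)"
      using c by (intro eq_matI) (auto simp: char_matrix_def)
    then show ?thesis using char_poly_matrix[OF c(3)] by simp
  qed
  have "poly (pencil_det M K * [:det ?X:]) z =
    poly ([:det (M * ?X):] * ((\<Prod>i<r. [:- \<mu> i, 1:]) * char_poly L2)) z" for z
  proof -
    have "poly (pencil_det M K * [:det ?X:]) z = det (z \<cdot>\<^sub>m M + K) * det ?X"
      using poly_pencil_det[OF M K] by simp
    also have "\<dots> = det ((z \<cdot>\<^sub>m M + K) * ?X)"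
      using M K X' by (intro det_mult[symmetric]) auto
    also have "\<dots> = det (M * ?X) * det (four_block_mat (z \<cdot>\<^sub>m 1\<^sub>m r - mat_diag r \<mu>)
        (0\<^sub>m r q) (0\<^sub>m q r) (z \<cdot>\<^sub>m 1\<^sub>m q - L2))"
      unfolding pencil_mult_hconcat[OF M K D N]
      using M X' c N by (intro det_mult[of _ N]) (auto intro!: four_block_carrier_mat minus_carrier_mat)
    also have "det (four_block_mat (z \<cdot>\<^sub>m 1\<^sub>m r - mat_diag r \<mu>)
        (0\<^sub>m r q) (0\<^sub>m q r) (z \<cdot>\<^sub>m 1\<^sub>m q - L2)) =
        (\<Prod>i<r. z - \<mu> i) * poly (char_poly L2) z"
      using c by (subst det_four_block_mat_lower_left_zero[of _ r _ q])
        (auto simp: det1 det2 intro!: minus_carrier_mat)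
    finally show ?thesis by (simp add: poly_prod)
  qed
  then have eq: "pencil_det M K * [:det ?X:] =
    [:det (M * ?X):] * ((\<Prod>i<r. [:- \<mu> i, 1:]) * char_poly L2)"
    by (intro poly_eq_poly_eq_iff[THEN iffD1] ext)
  have "(\<Prod>i<r. [:- \<mu> i, 1:]) =
      [:- \<mu> a, 1:] * ([:- \<mu> b, 1:] * (\<Prod>i\<in>{..<r} - {a} - {b}. [:- \<mu> i, 1:]))"
    using ab by (subst prod.remove[of _ a], simp, simp, subst prod.remove[of _ b]) auto
  then have "[:- \<mu> a, 1:] ^ 2 dvd (\<Prod>i<r. [:- \<mu> i, 1:])"
    using ab by (simp add: power2_eq_square mult.assoc[symmetric] del: mult_pCons_left mult_pCons_right)
  then have "[:- \<mu> a, 1:] ^ 2 dvd pencil_det M K * [:det ?X:]"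
    unfolding eq by (intro dvd_mult dvd_mult2)
  then have "[:- \<mu> a, 1:] ^ 2 dvd pencil_det M K"
    using detX by (simp add: mult.commute[of _ "[:det ?X:]"] dvd_smult_iff)
  moreover have "pencil_det M K \<noteq> 0" and "Polynomial.order (\<mu> a) (pencil_det M K) = 1"
    using simple by (auto simp: simple_eigenvalue_def regular_pencil_def)
  ultimately show False by (simp add: order_divides)
qed

section \<open>Matrices in the paired block pattern\<close>

lemma diag_block_mat_pairs:
  assumes "\<And>j. B j \<in> carrier_mat 2 2"
  shows "diag_block_mat (map B [1..<Suc m]) =
    mat (2 * m) (2 * m) (\<lambda>(i, j). if i div 2 = j div 2 then B (i div 2 + 1) $$ (i mod 2, j mod 2) else 0)"
proof (induction m)
  case 0
  show ?case by (intro eq_matI) auto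
next
  case (Suc m)
  have B: "dim_row (B j) = 2" "dim_col (B j) = 2" for j
    using assms[of j] by auto
  have last: "i div 2 = m \<and> i mod 2 = i - 2 * m" if "2 * m \<le> i" "i < 2 * m + 2" for i
    using that by presburger
  have early: "i div 2 < m" if "i < 2 * m" for i
    using that by linarith
  have e: "map B [1..<Suc (Suc m)] = map B [1..<Suc m] @ [B (Suc m)]" by simp
  let ?R = "\<lambda>i j. if i div 2 = j div 2 then B (i div 2 + 1) $$ (i mod 2, j mod 2) else 0"
  have eq: "diag_block_mat (map B [1..<Suc (Suc m)]) =
      four_block_mat (mat (2 * m) (2 * m) (\<lambda>(i, j). ?R i j)) (0\<^sub>m (2 * m) 2) (0\<^sub>m 2 (2 * m)) (B (Suc m))"
    (is "_ = ?F")
    unfolding e diag_block_mat_last Let_def Suc.IH by (simp add: B)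
  show ?case
  proof (rule eq_matI)
    fix i j assume "i < dim_row (mat (2 * Suc m) (2 * Suc m) (\<lambda>(i, j). ?R i j))"
      "j < dim_col (mat (2 * Suc m) (2 * Suc m) (\<lambda>(i, j). ?R i j))"
    then have ij: "i < 2 * m + 2" "j < 2 * m + 2" by auto
    have F: "?F $$ (i, j) = (if i < 2 * m then if j < 2 * m then ?R i j else 0
        else if j < 2 * m then 0 else B (Suc m) $$ (i - 2 * m, j - 2 * m))"
      using ij by (simp add: B)
    consider "i < 2 * m" "j < 2 * m" | "i < 2 * m" "2 * m \<le> j" | "2 * m \<le> i" "j < 2 * m"
      | "2 * m \<le> i" "2 * m \<le> j" by linarith
    then have "?F $$ (i, j) = ?R i j"
    proof cases
      case 1
      then show ?thesis unfolding F by simp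
    next
      case 2
      then show ?thesis unfolding F using early[of i] last[of j] ij by simp
    next
      case 3
      then show ?thesis unfolding F using early[of j] last[of i] ij by simp
    next
      case 4
      then have "\<not> i < 2 * m" "\<not> j < 2 * m" by simp_all
      then show ?thesis unfolding F using last[OF 4(1) ij(1)] last[OF 4(2) ij(2)] by simp
    qed
    then show "diag_block_mat (map B [1..<Suc (Suc m)]) $$ (i, j) =
        mat (2 * Suc m) (2 * Suc m) (\<lambda>(i, j). ?R i j) $$ (i, j)"
      unfolding eq using ij by simp
  qed (unfold eq, simp_all add: B)
qed

lemma diag_block_mat_scalars:
  "diag_block_mat (map (\<lambda>k. mat_of_rows_list 1 [[d k]]) [a..<a + k]) = mat_diag k (\<lambda>i. d (a + i))"
proof (induction k)
  case 0
  show ?case by (intro eq_matI) (auto simp: mat_diag_def)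
next
  case (Suc k)
  have e: "map (\<lambda>k. mat_of_rows_list 1 [[d k]]) [a..<a + Suc k] =
      map (\<lambda>k. mat_of_rows_list 1 [[d k]]) [a..<a + k] @ [mat_of_rows_list 1 [[d (a + k)]]]" by simp
  show ?case
    unfolding e diag_block_mat_last Let_def Suc.IH
    by (intro eq_matI) (auto simp: mat_diag_def mat_of_rows_list_def not_less less_Suc_eq)
qed

lemma paired_diag_eq:
  assumes B: "\<And>j. B j \<in> carrier_mat 2 2" and mp: "m \<le> p"
  shows "paired_diag m p B d = mat (m + p) (m + p) (\<lambda>(i, j).
    if i < 2 * m then
      if i div 2 = j div 2 then B (i div 2 + 1) $$ (i mod 2, j mod 2) else 0
    else if i = j then d (i - m + 1) else 0)"
proof -
  have split: "j div 2 \<noteq> i div 2" if "i < 2 * m" "2 * m \<le> j" for i j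
    using that by presburger
  have e: "map (\<lambda>k. mat_of_rows_list 1 [[d k]]) [Suc m..<Suc p] =
    map (\<lambda>k. mat_of_rows_list 1 [[d k]]) [Suc m..<Suc m + (p - m)]" using mp by simp
  let ?R = "\<lambda>i j. if i < 2 * m then
      if i div 2 = j div 2 then B (i div 2 + 1) $$ (i mod 2, j mod 2) else 0
    else if i = j then d (i - m + 1) else 0"
  have eq: "paired_diag m p B d = four_block_mat
    (mat (2 * m) (2 * m) (\<lambda>(i, j). if i div 2 = j div 2 then B (i div 2 + 1) $$ (i mod 2, j mod 2) else 0))
    (0\<^sub>m (2 * m) (p - m)) (0\<^sub>m (p - m) (2 * m)) (mat_diag (p - m) (\<lambda>i. d (Suc m + i)))"
    (is "_ = ?F")
    unfolding paired_diag_def e diag_block_mat_append Let_def diag_block_mat_pairs[OF B]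
      diag_block_mat_scalars by simp
  show ?thesis
  proof (rule eq_matI)
    fix i j assume "i < dim_row (mat (m + p) (m + p) (\<lambda>(i, j). ?R i j))"
      "j < dim_col (mat (m + p) (m + p) (\<lambda>(i, j). ?R i j))"
    then have ij: "i < m + p" "j < m + p" by auto
    have shift': "Suc i - m = Suc (i - m)" if "\<not> i < 2 * m" using that by simp
    have F: "?F $$ (i, j) = (if i < 2 * m then if j < 2 * m then
        if i div 2 = j div 2 then B (i div 2 + 1) $$ (i mod 2, j mod 2) else 0 else 0
        else if j < 2 * m then 0 else if i = j then d (i - m + 1) else 0)"
      using ij mp by (auto simp: mat_diag_def shift')
    have "?F $$ (i, j) = ?R i j"
      unfolding F using split[of i j] by auto
    then show "paired_diag m p B d $$ (i, j) = mat (m + p) (m + p) (\<lambda>(i, j). ?R i j) $$ (i, j)"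
      unfolding eq using ij by simp
  qed (use mp in \<open>simp_all add: eq\<close>)
qed

text \<open>
  The only column in which row \<open>i\<close> of \<open>G\<close>, \<open>Z\<^sub>1\<close> or \<open>Z\<^sub>2\<close> can have a nonzero entry, rows being counted
  from \<open>0\<close>.
\<close>

definition partner :: "nat \<Rightarrow> nat \<Rightarrow> nat" where
  "partner m i = (if i < 2 * m then if even i then i + 1 else i - 1 else i)"

text \<open>
  Rows are counted from \<open>0\<close> but the parameters \<open>l\<close> from \<open>1\<close>: row \<open>i < 2 * m\<close> lies in block
  \<open>i div 2 + 1\<close>, and row \<open>i \<ge> 2 * m\<close> carries the scalar with index \<open>i - m + 1\<close>.
\<close>

definition paired_entries :: "nat \<Rightarrow> (nat \<Rightarrow> complex) \<Rightarrow> nat \<Rightarrow> complex" where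
  "paired_entries m l i =
    (if i < 2 * m then if even i then l (i div 2 + 1) else - cnj (l (i div 2 + 1))
     else l (i - m + 1))"

lemma partner_less: "m \<le> p \<Longrightarrow> i < m + p \<Longrightarrow> partner m i < m + p"
  unfolding partner_def by presburger

lemma paired_entries_partner:
  assumes "\<forall>k\<in>{m+1..p}. Re (l k) = 0" "i < m + p"
  shows "paired_entries m l (partner m i) = - cnj (paired_entries m l i)"
proof (cases "i < 2 * m")
  case True
  have "(i + 1) div 2 = i div 2" "i + 1 < 2 * m" if "even i"
    using that True by presburger+
  moreover have "(i - 1) div 2 = i div 2" "even (i - 1)" if "odd i"
    using that by presburger+
  ultimately show ?thesis
    using True by (simp add: partner_def paired_entries_def)
next
  case False
  then have "Re (l (i - m + 1)) = 0" using assms by (intro assms(1)[rule_format]) auto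
  then show ?thesis using False
    by (auto simp: partner_def paired_entries_def complex_eq_iff)
qed

lemma eigenvalue_diag_eq:
  assumes "m \<le> p"
  shows "eigenvalue_diag m p l = mat_diag (m + p) (paired_entries m l)"
proof -
  have c: "mat_of_rows_list 2 [[l j, 0], [0, - cnj (l j)]] \<in> carrier_mat 2 2" for j
    by (auto simp: mat_of_rows_list_def)
  have block: "mat_of_rows_list 2 [[a, 0], [0, b]] $$ (i mod 2, j mod 2) =
      (if odd i = odd j then if even i then a else b else 0)" for a b :: complex and i j :: nat
    by (auto simp: mat_of_rows_list_def mod_2_eq_odd)
  have same: "i = j \<longleftrightarrow> i div 2 = j div 2 \<and> odd i = odd j" for i j :: nat
    by presburger
  show ?thesis
    unfolding eigenvalue_diag_def paired_diag_eq[OF c assms]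
  proof (rule eq_matI, goal_cases)
    case (1 i j)
    then have ij: "i < m + p" "j < m + p" by auto
    show ?case
    proof (cases "i = j")
      case True
      then show ?thesis using ij by (simp add: mat_diag_def paired_entries_def block)
    next
      case False
      then have "i div 2 \<noteq> j div 2 \<or> odd i \<noteq> odd j" using same by blast
      then show ?thesis using False ij by (auto simp: mat_diag_def block)
    qed
  qed simp_all
qed

lemma partner_iff:
  "j = partner m i \<longleftrightarrow> (if i < 2 * m then i div 2 = j div 2 \<and> odd i \<noteq> odd j else i = j)"
proof (cases "even i")
  case True
  then obtain k where "i = 2 * k" by (rule evenE)
  moreover have "j = 2 * k + 1 \<longleftrightarrow> k = j div 2 \<and> odd j" by presburger
  ultimately show ?thesis by (auto simp: partner_def)
next
  case False
  then obtain k where "i = 2 * k + 1" by (rule oddE)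
  moreover have "j = 2 * k \<longleftrightarrow> k = j div 2 \<and> even j" by presburger
  ultimately show ?thesis by (auto simp: partner_def)
qed

lemma partner_less_iff: "partner m i < 2 * m \<longleftrightarrow> i < 2 * m"
proof (cases "even i")
  case True
  then obtain k where "i = 2 * k" by (rule evenE)
  then show ?thesis by (simp add: partner_def)
next
  case False
  then obtain k where "i = 2 * k + 1" by (rule oddE)
  then show ?thesis by (simp add: partner_def)
qed

lemma partner_partner: "partner m (partner m i) = i"
  using partner_less_iff[of m i] by (auto simp: partner_def)

lemma paired_diag_off_diagonal:
  assumes mp: "m \<le> p" and ij: "i < m + p" "j < m + p"
  shows "paired_diag m p (\<lambda>j. mat_of_rows_list 2 [[0, a j], [b j, 0]]) z $$ (i, j) =
    (if j = partner m i then
      if i < 2 * m then if even i then a (i div 2 + 1) else b (i div 2 + 1) else z (i - m + 1)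
     else 0)"
proof -
  have c: "mat_of_rows_list 2 [[0, a j], [b j, 0]] \<in> carrier_mat 2 2" for j
    by (auto simp: mat_of_rows_list_def)
  have block: "mat_of_rows_list 2 [[0, x], [y, 0]] $$ (i mod 2, j mod 2) =
      (if odd i = odd j then 0 else if even i then x else y)" for x y :: complex and i j :: nat
    by (auto simp: mat_of_rows_list_def mod_2_eq_odd)
  show ?thesis
    unfolding paired_diag_eq[OF c mp] partner_iff using ij by (simp add: block)
qed

text \<open>
  The sign \<open>s\<close> covers the skew-Hermitian pattern of \<open>Z\<^sub>1\<close> and the Hermitian one of \<open>Z\<^sub>2\<close> together.
\<close>

lemma paired_diag_off_diagonal_adjoint:
  assumes mp: "m \<le> p" and ij: "i < m + p" "j < m + p"
    and ab: "\<And>k. b k = s * cnj (a k)" and s: "s = 1 \<or> s = -1"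
    and z: "\<And>k. k \<in> {m+1..p} \<Longrightarrow> cnj (z k) = s * z k"
  defines "A \<equiv> paired_diag m p (\<lambda>j. mat_of_rows_list 2 [[0, a j], [b j, 0]]) z"
  shows "cnj (A $$ (j, i)) = s * A $$ (i, j)"
proof -
  have ss: "cnj s = s" "s * (s * x) = x" for x using s by auto
  note entry = paired_diag_off_diagonal[OF mp, of _ _ a b z, folded A_def]
  show ?thesis
  proof (cases "j = partner m i")
    case False
    then have "i \<noteq> partner m j" using partner_partner by metis
    with False show ?thesis using entry[OF ij] entry[OF ij(2,1)] by simp
  next
    case True
    then have i: "i = partner m j" by (simp add: partner_partner)
    show ?thesis
    proof (cases "i < 2 * m")
      case less: True
      then have "j < 2 * m" "i div 2 = j div 2" "odd i \<noteq> odd j"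
        using True partner_less_iff[of m i] partner_iff[of j m i] by simp_all
      then show ?thesis
        unfolding entry[OF ij] entry[OF ij(2,1)] using less True[symmetric] i[symmetric]
        by (auto simp: ab ss)
    next
      case False
      then have "j = i" using True by (simp add: partner_def)
      moreover have "i - m + 1 \<in> {m+1..p}" using False ij by auto
      ultimately show ?thesis
        using z False entry[OF ij] True by simp
    qed
  qed
qed

lemma paired_diag_carrier:
  "m \<le> p \<Longrightarrow> paired_diag m p (\<lambda>j. mat_of_rows_list 2 [[0, a j], [b j, 0]]) z \<in> carrier_mat (m + p) (m + p)"
  by (subst paired_diag_eq) (auto simp: mat_of_rows_list_def)

lemma paired_diag_skew_adjoint:
  assumes mp: "m \<le> p" and z: "\<forall>k\<in>{m+1..p}. Re (z k) = 0"
  shows "mat_adjoint (paired_diag m p (\<lambda>j. mat_of_rows_list 2 [[0, a j], [- cnj (a j), 0]]) z) =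
    - paired_diag m p (\<lambda>j. mat_of_rows_list 2 [[0, a j], [- cnj (a j), 0]]) z"
proof -
  let ?A = "paired_diag m p (\<lambda>j. mat_of_rows_list 2 [[0, a j], [- cnj (a j), 0]]) z"
  have "cnj (?A $$ (j, i)) = -1 * ?A $$ (i, j)" if "i < m + p" "j < m + p" for i j
    by (rule paired_diag_off_diagonal_adjoint[OF mp that]) (use z in \<open>auto simp: complex_eq_iff\<close>)
  then show ?thesis
    using carrier_matD[OF paired_diag_carrier[OF mp, of a "\<lambda>j. - cnj (a j)" z]]
    by (intro eq_matI) simp_all
qed

lemma paired_diag_self_adjoint:
  assumes mp: "m \<le> p" and z: "\<forall>k\<in>{m+1..p}. z k \<in> \<real>"
  shows "mat_adjoint (paired_diag m p (\<lambda>j. mat_of_rows_list 2 [[0, a j], [cnj (a j), 0]]) z) =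
    paired_diag m p (\<lambda>j. mat_of_rows_list 2 [[0, a j], [cnj (a j), 0]]) z"
proof -
  let ?A = "paired_diag m p (\<lambda>j. mat_of_rows_list 2 [[0, a j], [cnj (a j), 0]]) z"
  have "cnj (?A $$ (j, i)) = 1 * ?A $$ (i, j)" if "i < m + p" "j < m + p" for i j
    by (rule paired_diag_off_diagonal_adjoint[OF mp that]) (use z in \<open>auto simp: Reals_cnj_iff\<close>)
  then show ?thesis
    using carrier_matD[OF paired_diag_carrier[OF mp, of a "\<lambda>j. cnj (a j)" z]]
    by (intro eq_matI) simp_all
qed

text \<open>
  Simplicity is only assumed for the \<open>l i\<close>, not for the reflected values \<open>- cnj (l i)\<close>.  A
  coincidence involving some \<open>l i\<close> is excluded by \<open>repeated_entry_not_simple\<close>; two equal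
  reflected values stem from two equal \<open>l i\<close>.
\<close>

lemma paired_entries_inj:
  assumes M: "M \<in> carrier_mat N N" and K: "K \<in> carrier_mat N N" and mp: "m \<le> p"
    and compl: "complementary_deflating_pairs N (m + p) q M K X1 (mat_diag (m + p) (paired_entries m l)) X2 L2"
    and simple: "\<forall>i\<in>{1..p}. simple_eigenvalue M K (l i)"
    and ij: "i < m + p" "j < m + p" "paired_entries m l i = paired_entries m l j"
  shows "i = j"
proof (rule ccontr)
  assume ne: "i \<noteq> j"
  note no = repeated_entry_not_simple[OF M K compl]
  \<comment> \<open>Only the odd rows of a block carry a reflected value.\<close>
  have unrepeated: False if "a < m + p" "b < m + p" "a \<noteq> b" "paired_entries m l a = paired_entries m l b"
    and a: "\<not> (a < 2 * m \<and> odd a)" for a b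
  proof -
    obtain k where "k \<in> {1..p}" "paired_entries m l a = l k"
    proof (cases "a < 2 * m")
      case True
      with a mp show thesis
        by (intro that[of "a div 2 + 1"]) (auto simp: paired_entries_def)
    next
      case False
      with \<open>a < m + p\<close> show thesis
        by (intro that[of "a - m + 1"]) (auto simp: paired_entries_def)
    qed
    with simple no[OF that(1-4)] show False by simp
  qed
  have "i < 2 * m" "odd i" using unrepeated[OF ij(1,2) ne ij(3)] by auto
  moreover have "j < 2 * m" "odd j" using unrepeated[OF ij(2,1) ne[symmetric] ij(3)[symmetric]] by auto
  ultimately have lt: "i - 1 < m + p" "j - 1 < m + p" "i - 1 \<noteq> j - 1"
    "\<not> (i - 1 < 2 * m \<and> odd (i - 1))" "paired_entries m l (i - 1) = paired_entries m l (j - 1)"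
    using ij ne by (auto simp: paired_entries_def elim!: oddE)
  then show False using unrepeated[of "i - 1" "j - 1"] by blast
qed

section \<open>The small matrices of the perturbation\<close>

text \<open>
  All factors other than \<open>G\<close>, \<open>Z1\<close>, \<open>Z2\<close> are diagonal, so with \<open>h = 1 / (1 + \<bar>d\<bar>\<^sup>2)\<close> the
  entry \<open>(i, j)\<close> is a linear combination of the entries \<open>(i, j)\<close> of these three matrices with coefficients
  depending on \<open>\<mu> j\<close> and \<open>d j\<close> only.  Where one of them is nonzero, passing from \<open>(j, i)\<close> to
  \<open>(i, j)\<close> replaces \<open>\<mu> i\<close>, \<open>d i\<close> by
  their negative conjugates and leaves \<open>h\<close> unchanged, which yields both symmetries.
\<close>

lemma hat_matrices:
  fixes \<mu> d :: "nat \<Rightarrow> complex" and r :: nat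
  defines "L \<equiv> mat_diag r \<mu>" and "D \<equiv> mat_diag r d"
  assumes c: "G \<in> carrier_mat r r" "Z1 \<in> carrier_mat r r" "Z2 \<in> carrier_mat r r"
    and adj: "mat_adjoint G = - G" "mat_adjoint Z1 = - Z1" "mat_adjoint Z2 = Z2"
    and supp: "\<And>i j. i < r \<Longrightarrow> j < r \<Longrightarrow>
      G $$ (i, j) \<noteq> 0 \<or> Z1 $$ (i, j) \<noteq> 0 \<or> Z2 $$ (i, j) \<noteq> 0 \<Longrightarrow>
      \<mu> j = - cnj (\<mu> i) \<and> d j = - cnj (d i)"
    and H: "H = minv (mat_adjoint D * D + 1\<^sub>m r)"
    and Mh: "Mh = G * (L - D) * H * mat_adjoint D + Z1 * (1\<^sub>m r - D * H * mat_adjoint D)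
                  - Z2 * H * mat_adjoint D"
    and Kh: "Kh = G * (L - D) * H - Z1 * D * H + Z2 * (1\<^sub>m r - H)"
  shows "Mh \<in> carrier_mat r r" "Kh \<in> carrier_mat r r"
    and "mat_adjoint Mh = - Mh" "mat_adjoint Kh = Kh"
    and "Mh * D + Kh = G * (L - D)"
proof -
  define h where "h i = inverse (cnj (d i) * d i + 1)" for i
  have nz: "cnj (d i) * d i + 1 \<noteq> 0" for i
  proof -
    have "cnj (d i) * d i + 1 = complex_of_real ((cmod (d i))\<^sup>2 + 1)"
      by (simp add: complex_norm_square mult.commute del: of_real_power)
    moreover have "(cmod (d i))\<^sup>2 + 1 \<noteq> 0" using zero_le_power2[of "cmod (d i)"] by linarith
    ultimately show ?thesis by (metis of_real_eq_0_iff)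
  qed
  then have h: "h i * (cnj (d i) * d i + 1) = 1" for i
    by (simp add: h_def)
  have h_cnj: "cnj (h i) = h i" for i
    by (simp add: h_def mult.commute)
  have "mat_adjoint D * D + 1\<^sub>m r = mat_diag r (\<lambda>i. cnj (d i) * d i + 1)"
    unfolding D_def mat_adjoint_mat_diag mat_diag_diag by (intro eq_matI) (auto simp: mat_diag_def)
  then have H': "H = mat_diag r h"
    using nz by (simp add: H minv_mat_diag h_def[abs_def])
  have diff: "mat_diag r f - mat_diag r g = mat_diag r (\<lambda>i. f i - g i)" for f g :: "nat \<Rightarrow> complex"
    by (intro eq_matI) (auto simp: mat_diag_def)
  have one: "1\<^sub>m r = mat_diag r (\<lambda>i. 1 :: complex)" by simp
  have Mh': "Mh = G * mat_diag r (\<lambda>i. (\<mu> i - d i) * h i * cnj (d i))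
      + Z1 * mat_diag r (\<lambda>i. 1 - d i * h i * cnj (d i)) - Z2 * mat_diag r (\<lambda>i. h i * cnj (d i))"
    unfolding Mh L_def D_def H' mat_adjoint_mat_diag one diff mat_diag_diag
    using c by (simp add: mult_mat_diag_mult_mat_diag diff del: mat_diag_one assoc_mult_mat)
  have Kh': "Kh = G * mat_diag r (\<lambda>i. (\<mu> i - d i) * h i)
      - Z1 * mat_diag r (\<lambda>i. d i * h i) + Z2 * mat_diag r (\<lambda>i. 1 - h i)"
    unfolding Kh L_def D_def H' one diff
    using c by (simp add: mult_mat_diag_mult_mat_diag diff del: mat_diag_one assoc_mult_mat)
  show cM: "Mh \<in> carrier_mat r r" and cK: "Kh \<in> carrier_mat r r"
    unfolding Mh' Kh' using c by (auto intro!: add_carrier_mat minus_carrier_mat)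
  have Mh_ij: "Mh $$ (i, j) = G $$ (i, j) * ((\<mu> j - d j) * h j * cnj (d j))
      + Z1 $$ (i, j) * (1 - d j * h j * cnj (d j)) - Z2 $$ (i, j) * (h j * cnj (d j))"
    if "i < r" "j < r" for i j
    unfolding Mh' using c that by (simp add: index_mult_mat_diag[of _ r] del: index_mult_mat(1))
  have Kh_ij: "Kh $$ (i, j) = G $$ (i, j) * ((\<mu> j - d j) * h j)
      - Z1 $$ (i, j) * (d j * h j) + Z2 $$ (i, j) * (1 - h j)"
    if "i < r" "j < r" for i j
    unfolding Kh' using c that by (simp add: index_mult_mat_diag[of _ r] del: index_mult_mat(1))
  have adj_ij: "G $$ (j, i) = - cnj (G $$ (i, j))" "Z1 $$ (j, i) = - cnj (Z1 $$ (i, j))"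
    "Z2 $$ (j, i) = cnj (Z2 $$ (i, j))" if "i < r" "j < r" for i j
  proof -
    have "mat_adjoint G $$ (j, i) = cnj (G $$ (i, j))" "mat_adjoint Z1 $$ (j, i) = cnj (Z1 $$ (i, j))"
      "mat_adjoint Z2 $$ (j, i) = cnj (Z2 $$ (i, j))" using c that by auto
    then show "G $$ (j, i) = - cnj (G $$ (i, j))" "Z1 $$ (j, i) = - cnj (Z1 $$ (i, j))"
      "Z2 $$ (j, i) = cnj (Z2 $$ (i, j))" unfolding adj using c that
      by (auto simp: minus_equation_iff[of "G $$ (j, i)"] minus_equation_iff[of "Z1 $$ (j, i)"])
  qed
  have sym: "cnj (Mh $$ (j, i)) = - Mh $$ (i, j) \<and> cnj (Kh $$ (j, i)) = Kh $$ (i, j)"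
    if ij: "i < r" "j < r" for i j
  proof (cases "G $$ (i, j) \<noteq> 0 \<or> Z1 $$ (i, j) \<noteq> 0 \<or> Z2 $$ (i, j) \<noteq> 0")
    case True
    then have rel: "\<mu> j = - cnj (\<mu> i)" "d j = - cnj (d i)" using supp ij by auto
    then have hj: "h j = h i" by (simp add: h_def mult.commute)
    show ?thesis
      unfolding Mh_ij[OF ij] Mh_ij[OF ij(2,1)] Kh_ij[OF ij] Kh_ij[OF ij(2,1)] adj_ij[OF ij] hj rel
      by (simp add: h_cnj algebra_simps)
  next
    case False
    then show ?thesis
      unfolding Mh_ij[OF ij] Mh_ij[OF ij(2,1)] Kh_ij[OF ij] Kh_ij[OF ij(2,1)] adj_ij[OF ij] by simp
  qed
  show "mat_adjoint Mh = - Mh"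
    using cM sym by (intro eq_matI) auto
  show "mat_adjoint Kh = Kh"
    using cK sym by (intro eq_matI) auto
  show "Mh * D + Kh = G * (L - D)"
  proof (rule eq_matI)
    fix i j assume "i < dim_row (G * (L - D))" "j < dim_col (G * (L - D))"
    then have ij: "i < r" "j < r" using c by (auto simp: L_def D_def mat_diag_def)
    have hd: "h j * (cnj (d j) * d j) = 1 - h j" using h[of j] by (simp add: algebra_simps)
    have "(Mh * D + Kh) $$ (i, j) = Mh $$ (i, j) * d j + Kh $$ (i, j)"
      using cM cK ij by (simp add: D_def index_mult_mat_diag[of _ r] del: index_mult_mat(1))
    also have "\<dots> = G $$ (i, j) * ((\<mu> j - d j) * (h j * (cnj (d j) * d j) + h j))
        + Z1 $$ (i, j) * (d j * (1 - h j * (cnj (d j) * d j) - h j))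
        + Z2 $$ (i, j) * (1 - h j - h j * (cnj (d j) * d j))"
      unfolding Mh_ij[OF ij] Kh_ij[OF ij] by (simp add: algebra_simps)
    also have "\<dots> = G $$ (i, j) * (\<mu> j - d j)" unfolding hd by simp
    also have "\<dots> = (G * (L - D)) $$ (i, j)"
      unfolding L_def D_def diff using c ij by (simp add: index_mult_mat_diag[of _ r] del: index_mult_mat(1))
    finally show "(Mh * D + Kh) $$ (i, j) = (G * (L - D)) $$ (i, j)" .
  qed (use c cM cK in \<open>auto simp: L_def D_def mat_diag_def\<close>)
qed

section \<open>The Sylvester equation\<close>

lemma mat_diag_spectrum: "i < k \<Longrightarrow> \<mu> i \<in> spectrum (mat_diag k \<mu>)" for \<mu> :: "nat \<Rightarrow> complex"
  unfolding spectrum_def eigenvalue_def eigenvector_def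
  by (auto intro!: exI[of _ "unit_vec k i"] eq_vecI simp: mat_diag_def scalar_prod_right_unit)

text \<open>
  The conjugate of the \<open>i\<close>-th row of a solution \<open>Y\<close> is either zero or an eigenvector of \<open>- L\<^sup>*\<close>
  for the eigenvalue \<open>\<mu> i\<close>.
\<close>

lemma sylvester_diag_trivial:
  fixes \<mu> :: "nat \<Rightarrow> complex"
  assumes c: "Y \<in> carrier_mat r q" "L \<in> carrier_mat q q"
    and eq: "Y * L = - (mat_adjoint (mat_diag r \<mu>) * Y)"
    and disj: "spectrum (mat_diag r \<mu>) \<inter> spectrum (- mat_adjoint L) = {}"
  shows "Y = 0\<^sub>m r q"
proof -
  have "vec q (\<lambda>j. cnj (Y $$ (i, j))) = 0\<^sub>v q" if i: "i < r" for i
  proof (rule ccontr)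
    let ?v = "vec q (\<lambda>j. cnj (Y $$ (i, j)))"
    assume nz: "?v \<noteq> 0\<^sub>v q"
    have "(- mat_adjoint L) *\<^sub>v ?v = \<mu> i \<cdot>\<^sub>v ?v"
    proof (rule eq_vecI)
      fix k assume "k < dim_vec (\<mu> i \<cdot>\<^sub>v ?v)"
      then have k: "k < q" by simp
      have "((- mat_adjoint L) *\<^sub>v ?v) $ k = - cnj ((Y * L) $$ (i, k))"
        using c i k by (auto simp: scalar_prod_def sum_negf[symmetric] mult.commute intro!: sum.cong)
      also have "\<dots> = \<mu> i * cnj (Y $$ (i, k))"
        unfolding eq mat_adjoint_mat_diag using c i k by (subst mat_diag_mult_left) auto
      finally show "((- mat_adjoint L) *\<^sub>v ?v) $ k = (\<mu> i \<cdot>\<^sub>v ?v) $ k" using k by simp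
    qed (use c in auto)
    then have "\<mu> i \<in> spectrum (- mat_adjoint L)"
      using nz c unfolding spectrum_def eigenvalue_def eigenvector_def by (auto intro!: exI[of _ ?v])
    with disj mat_diag_spectrum[OF i, of \<mu>] show False by auto
  qed
  then have "Y $$ (i, j) = 0" if "i < r" "j < q" for i j
    using that by (metis complex_cnj_zero_iff index_vec index_zero_vec(1))
  then show ?thesis using c by (intro eq_matI) auto
qed

section \<open>Structured perturbation of deflating pairs\<close>

lemma J_mat_carrier [simp]: "J_mat n \<in> carrier_mat (2 * n) (2 * n)"
  unfolding J_mat_def mult_2 by (intro four_block_carrier_mat) auto

lemma J_mat_transpose:
  "J_mat n * transpose_mat (J_mat n) = 1\<^sub>m (2 * n)" "transpose_mat (J_mat n) * J_mat n = 1\<^sub>m (2 * n)"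
proof -
  have t: "transpose_mat (J_mat n) = four_block_mat (0\<^sub>m n n) (- 1\<^sub>m n) (1\<^sub>m n) (0\<^sub>m n n)"
    unfolding J_mat_def
    by (subst transpose_four_block_mat[of _ n n _ n _ n]) (auto simp: transpose_uminus)
  have o: "four_block_mat (1\<^sub>m n) (0\<^sub>m n n) (0\<^sub>m n n) (1\<^sub>m n) = (1\<^sub>m (2 * n) :: complex mat)"
    by (intro eq_matI) auto
  have z: "- 0\<^sub>m n n = (0\<^sub>m n n :: complex mat)"
    by (intro eq_matI) auto
  have nn: "- (- 1\<^sub>m n) = (1\<^sub>m n :: complex mat)"
    by (intro eq_matI) auto
  show "J_mat n * transpose_mat (J_mat n) = 1\<^sub>m (2 * n)"
    unfolding t unfolding J_mat_def o[symmetric]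
    by (subst mult_four_block_mat[of _ n n _ n _ n _ _ n _ n]) (simp_all add: nn z)
  show "transpose_mat (J_mat n) * J_mat n = 1\<^sub>m (2 * n)"
    unfolding t unfolding J_mat_def o[symmetric]
    by (subst mult_four_block_mat[of _ n n _ n _ n _ _ n _ n]) (simp_all add: nn z)
qed

text \<open>
  With \<open>S = J M\<close> and \<open>T = J K\<close> the deflating equation gives \<open>X\<^sup>* T X = - G diag \<mu>\<close>.  The left side
  is Hermitian and \<open>G\<close> is skew-Hermitian; comparing the entries \<open>(i, j)\<close> and \<open>(j, i)\<close> gives
  \<open>G\<^sub>i\<^sub>j (\<mu> j + cnj (\<mu> i)) = 0\<close>.
\<close>

lemma deflating_gram_matrix:
  fixes \<mu> :: "nat \<Rightarrow> complex"
  assumes SHH: "star_SHH n M K" and cX: "X \<in> carrier_mat (2 * n) r"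
    and eq: "M * X * mat_diag r \<mu> + K * X = 0\<^sub>m (2 * n) r"
    and G: "G = mat_adjoint X * J_mat n * M * X"
  shows "G \<in> carrier_mat r r" "mat_adjoint G = - G"
    and "\<And>i j. i < r \<Longrightarrow> j < r \<Longrightarrow> G $$ (i, j) \<noteq> 0 \<Longrightarrow> \<mu> j = - cnj (\<mu> i)"
proof -
  define N where "N = 2 * n"
  define J where "J = J_mat n"
  define S where "S = J * M"
  define T where "T = J * K"
  define L where "L = mat_diag r \<mu>"
  have cJ: "J \<in> carrier_mat N N" by (auto simp: J_def N_def)
  have cM: "M \<in> carrier_mat N N" and cK: "K \<in> carrier_mat N N"
    and S_adj: "mat_adjoint S = - S" and T_adj: "mat_adjoint T = T"
    using SHH unfolding star_SHH_def star_skew_Hamiltonian_def star_Hamiltonian_def S_def T_def J_def N_def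
    by auto
  have cS: "S \<in> carrier_mat N N" and cT: "T \<in> carrier_mat N N"
    unfolding S_def T_def using cJ cM cK by auto
  have cX: "X \<in> carrier_mat N r" using cX by (simp add: N_def)
  have cL: "L \<in> carrier_mat r r" by (simp add: L_def)
  have cXa: "mat_adjoint X \<in> carrier_mat r N" using cX by simp
  have cSX: "S * X \<in> carrier_mat N r" using cS cX by auto
  have G': "G = mat_adjoint X * (S * X)"
    unfolding G J_def[symmetric] S_def using cJ cM cX cXa
    by (simp add: assoc_mult_mat[of _ r N _ N] assoc_mult_mat[of _ N N _ N])
  show cG: "G \<in> carrier_mat r r" unfolding G' using cXa cSX by auto
  have SX_adj: "mat_adjoint (S * X) = - (mat_adjoint X * S)"
    using mat_adjoint_mult[OF cS cX] S_adj cX cS by simp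
  show G_adj: "mat_adjoint G = - G"
    unfolding G' using mat_adjoint_mult[OF cXa cSX] SX_adj cS cX cXa
    by (simp add: assoc_mult_mat[of _ r N _ N _ r])
  have "mat_adjoint X * (J * (M * X * L + K * X)) = G * L + mat_adjoint X * (T * X)"
    unfolding G' S_def T_def using cJ cM cK cX cXa cL
    by (simp add: mult_add_distrib_mat[of _ N N _ r] mult_add_distrib_mat[of _ r N _ r]
        assoc_mult_mat[of _ N N _ N _ r]
        assoc_mult_mat[of _ N N _ r _ r] assoc_mult_mat[of _ N r _ r _ r] assoc_mult_mat[of _ r N _ r _ r])
  then have z: "G * L + mat_adjoint X * (T * X) = 0\<^sub>m r r"
    using eq cJ right_mult_zero_mat[OF cXa] unfolding L_def N_def[symmetric] by simp
  have P_adj: "mat_adjoint (mat_adjoint X * (T * X)) = mat_adjoint X * (T * X)"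
    using mat_adjoint_mult[OF cXa, of "T * X" r] mat_adjoint_mult[OF cT cX] T_adj cT cX cXa
    by (simp add: assoc_mult_mat[of _ r N _ N _ r])
  have cP: "mat_adjoint X * (T * X) \<in> carrier_mat r r" using cXa cT cX by auto
  fix i j assume ij: "i < r" "j < r" and nz: "G $$ (i, j) \<noteq> 0"
  have P: "(mat_adjoint X * (T * X)) $$ (k, l) = - (G $$ (k, l) * \<mu> l)" if "k < r" "l < r" for k l
  proof -
    have "(G * L + mat_adjoint X * (T * X)) $$ (k, l) = 0" using z that by simp
    then show ?thesis
      using that cG cP cX cT by (simp add: L_def index_mult_mat_diag[of _ r] add_eq_0_iff del: index_mult_mat(1))
  qed
  have "(mat_adjoint X * (T * X)) $$ (i, j) = cnj ((mat_adjoint X * (T * X)) $$ (j, i))"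
    using P_adj cP ij by (metis carrier_matD mat_adjoint_index)
  moreover have "cnj (G $$ (j, i)) = - G $$ (i, j)"
    using G_adj cG ij by (metis carrier_matD index_uminus_mat(1) mat_adjoint_index)
  ultimately have "G $$ (i, j) * \<mu> j = - (G $$ (i, j) * cnj (\<mu> i))"
    using P[OF ij] P[OF ij(2,1)] by (simp add: minus_equation_iff[of "G $$ (i, j) * \<mu> j"])
  then have "G $$ (i, j) * (\<mu> j + cnj (\<mu> i)) = 0"
    by (simp add: distrib_left)
  with nz show "\<mu> j = - cnj (\<mu> i)" by (simp add: eq_neg_iff_add_eq_0)
qed

text \<open>
  The perturbations act only through \<open>U\<^sup>*\<close>, and \<open>U\<^sup>* X\<^sub>c = I\<close>, \<open>U\<^sup>* X\<^sub>f = 0\<close>.  So \<open>X\<^sub>f\<close> keeps its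
  deflating equation, and since \<open>J\<^sup>T U G = M X\<^sub>c\<close> the hypothesis \<open>hat\<close> is exactly what turns the
  equation for \<open>diag \<mu>\<close> into the one for \<open>D\<close>.  The symmetry follows from \<open>J DM = U Mh U\<^sup>*\<close>
  and \<open>J DK = U Kh U\<^sup>*\<close>.
\<close>

lemma structured_perturbation:
  fixes \<mu> :: "nat \<Rightarrow> complex"
  assumes SHH: "star_SHH n M K"
    and compl: "complementary_deflating_pairs (2 * n) r q M K Xc (mat_diag r \<mu>) Xf Lf"
    and disjoint: "spectrum (mat_diag r \<mu>) \<inter> spectrum (- mat_adjoint Lf) = {}"
    and G: "G = mat_adjoint Xc * J_mat n * M * Xc"
    and G_nonsing: "invertible_mat G"
    and U: "U = J_mat n * M * Xc * minv G"
    and D: "D \<in> carrier_mat r r"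
    and Mh: "Mh \<in> carrier_mat r r" "mat_adjoint Mh = - Mh"
    and Kh: "Kh \<in> carrier_mat r r" "mat_adjoint Kh = Kh"
    and hat: "Mh * D + Kh = G * (mat_diag r \<mu> - D)"
    and DM: "DM = transpose_mat (J_mat n) * U * Mh * mat_adjoint U"
    and DK: "DK = transpose_mat (J_mat n) * U * Kh * mat_adjoint U"
  shows "complementary_deflating_pairs (2 * n) r q (M + DM) (K + DK) Xc D Xf Lf"
    and "star_skew_Hamiltonian n DM" and "star_Hamiltonian n DK"
proof -
  define N where "N = 2 * n"
  define J where "J = J_mat n"
  define S where "S = J * M"
  define T where "T = J * K"
  define L where "L = mat_diag r \<mu>"
  define W where "W = minv G"
  have cJ: "J \<in> carrier_mat N N" "transpose_mat J \<in> carrier_mat N N"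
    by (auto simp: J_def N_def)
  have JJ: "J * transpose_mat J = 1\<^sub>m N" "transpose_mat J * J = 1\<^sub>m N"
    unfolding J_def N_def by (rule J_mat_transpose)+
  have cM: "M \<in> carrier_mat N N" and cK: "K \<in> carrier_mat N N"
    and S_adj: "mat_adjoint S = - S" and T_adj: "mat_adjoint T = T"
    using SHH unfolding star_SHH_def star_skew_Hamiltonian_def star_Hamiltonian_def S_def T_def J_def N_def
    by auto
  have cS: "S \<in> carrier_mat N N" and cT: "T \<in> carrier_mat N N"
    unfolding S_def T_def using cJ cM cK by auto
  have Dc: "deflating_pair N r M K Xc L" and Df: "deflating_pair N q M K Xf Lf"
    and inv: "invertible_mat (hconcat Xc Xf)"
    using compl by (auto simp: complementary_deflating_pairs_def N_def L_def)
  have cX: "Xc \<in> carrier_mat N r" "Xf \<in> carrier_mat N q" "Lf \<in> carrier_mat q q" "L \<in> carrier_mat r r"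
    using Dc Df by (auto simp: deflating_pair_def)
  have eqc: "M * Xc * L + K * Xc = 0\<^sub>m N r" and eqf: "M * Xf * Lf + K * Xf = 0\<^sub>m N q"
    using Dc Df by (auto simp: deflating_pair_def)
  have JX: "T * X = - (S * X * Y)"
    if "M * X * Y + K * X = 0\<^sub>m N k" "X \<in> carrier_mat N k" "Y \<in> carrier_mat k k" for X Y k
  proof -
    have "J * (M * X * Y + K * X) = S * X * Y + T * X"
      using that(2,3) cJ cM cK unfolding S_def T_def
      by (simp add: mult_add_distrib_mat[of _ N N _ k] assoc_mult_mat[of _ N N _ N _ k]
          assoc_mult_mat[of _ N N _ k _ k] assoc_mult_mat[of _ N k _ k _ k])
    then have z: "S * X * Y + T * X = 0\<^sub>m N k"
      using that(1) cJ by simp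
    show ?thesis
    proof (rule eq_matI)
      fix i j assume "i < dim_row (- (S * X * Y))" "j < dim_col (- (S * X * Y))"
      then have ij: "i < N" "j < k" using cS that by auto
      then have "(S * X * Y + T * X) $$ (i, j) = 0" using z by simp
      then show "(T * X) $$ (i, j) = (- (S * X * Y)) $$ (i, j)"
        using ij cS cT that by (simp add: add_eq_0_iff del: index_mult_mat(1))
    qed (use cS cT that in auto)
  qed
  have G': "G = mat_adjoint Xc * (S * Xc)"
    unfolding G J_def[symmetric] S_def using cJ cM cX
    by (simp add: assoc_mult_mat[of _ r N _ N] assoc_mult_mat[of _ N N _ N])
  have cG: "G \<in> carrier_mat r r" and G_adj: "mat_adjoint G = - G"
    using deflating_gram_matrix(1,2)[OF SHH cX(1)[unfolded N_def] eqc[unfolded L_def N_def] G] by simp_all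
  have W: "G * W = 1\<^sub>m r" "W * G = 1\<^sub>m r" "W \<in> carrier_mat r r"
    unfolding W_def using minv_inverse[OF cG G_nonsing] by auto
  have U': "U = S * Xc * W" unfolding U S_def W_def J_def[symmetric] ..
  have cSX: "S * Xc \<in> carrier_mat N r" using cS cX by auto
  have cU: "U \<in> carrier_mat N r" unfolding U' using cSX W by auto
  have cUa: "mat_adjoint U \<in> carrier_mat r N" using cU by simp
  have cA: "mat_adjoint Xc \<in> carrier_mat r N" "mat_adjoint Xc * S \<in> carrier_mat r N"
      "mat_adjoint W \<in> carrier_mat r r" "mat_adjoint L \<in> carrier_mat r r"
      "T * Xc \<in> carrier_mat N r" "T * Xf \<in> carrier_mat N q" "S * Xf \<in> carrier_mat N q"
    using cX cS cT W by (auto intro!: mult_carrier_mat mat_adjoint_carrier)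
  have UG: "U * G = S * Xc"
    unfolding U' using assoc_mult_mat[OF cSX W(3) cG] W right_mult_one_mat[OF cSX] by simp
  have SX_adj: "mat_adjoint (S * Xc) = - (mat_adjoint Xc * S)"
    using mat_adjoint_mult[OF cS cX(1)] S_adj cX cS by simp
  have U_adj: "mat_adjoint U * Y = - (mat_adjoint W * (mat_adjoint Xc * (S * Y)))"
    if "Y \<in> carrier_mat N k" for Y k
  proof -
    have "mat_adjoint U = mat_adjoint W * - (mat_adjoint Xc * S)"
      unfolding U' using mat_adjoint_mult[OF cSX W(3)] SX_adj by simp
    then show ?thesis
      using that W cX cS cA by (simp add: assoc_mult_mat[of _ r r _ N _ k] assoc_mult_mat[of _ r N _ N _ k])
  qed
  \<comment> \<open>\<open>U\<^sup>* X\<^sub>c = I\<close> because \<open>U\<^sup>* X\<^sub>c = - W\<^sup>* G = W\<^sup>* G\<^sup>* = (G W)\<^sup>*\<close>.\<close>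
  have UXc: "mat_adjoint U * Xc = 1\<^sub>m r"
  proof -
    have "mat_adjoint U * Xc = - (mat_adjoint W * G)" using U_adj[OF cX(1)] G' by simp
    also have "\<dots> = mat_adjoint W * mat_adjoint G" using G_adj cA cG W by simp
    also have "\<dots> = 1\<^sub>m r" using mat_adjoint_mult[OF cG W(3)] W by simp
    finally show ?thesis .
  qed
  have cY: "mat_adjoint Xc * (S * Xf) \<in> carrier_mat r q" using cX cS by auto
  have "mat_adjoint Xc * (S * Xf) = 0\<^sub>m r q"
  proof (rule sylvester_diag_trivial[OF cY cX(3)])
    have "mat_adjoint Xc * (S * Xf) * Lf = mat_adjoint Xc * (S * Xf * Lf)"
      using cX cS cA by (intro assoc_mult_mat[of _ r N _ q _ q]) auto
    also have "\<dots> = - (mat_adjoint Xc * (T * Xf))"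
      using JX[OF eqf cX(2,3)] cX cS cA by (simp add: assoc_mult_mat[of _ N N _ q _ q])
    also have "mat_adjoint Xc * (T * Xf) = mat_adjoint (T * Xc) * Xf"
      using mat_adjoint_mult[OF cT cX(1)] T_adj cX cT cA by (simp add: assoc_mult_mat[of _ r N _ N _ q])
    also have "mat_adjoint (T * Xc) = mat_adjoint L * (mat_adjoint Xc * S)"
      unfolding JX[OF eqc cX(1,4)] mat_adjoint_uminus mat_adjoint_mult[OF cSX cX(4)] SX_adj
      using cX cS cA by simp
    also have "mat_adjoint L * (mat_adjoint Xc * S) * Xf = mat_adjoint L * (mat_adjoint Xc * (S * Xf))"
      using cX cS cA by (simp add: assoc_mult_mat[of _ r r _ N _ q] assoc_mult_mat[of _ r N _ N _ q])
    finally show "mat_adjoint Xc * (S * Xf) * Lf =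
        - (mat_adjoint (mat_diag r \<mu>) * (mat_adjoint Xc * (S * Xf)))" unfolding L_def .
  qed (rule disjoint)
  then have UXf: "mat_adjoint U * Xf = 0\<^sub>m r q"
    using U_adj[OF cX(2)] right_mult_zero_mat[OF cA(3)] by (auto intro!: eq_matI)
  have DX: "transpose_mat J * U * A * mat_adjoint U * X = transpose_mat J * (U * (A * (mat_adjoint U * X)))"
    if "A \<in> carrier_mat r r" "X \<in> carrier_mat N k" for A X k
  proof -
    have cAU: "A * mat_adjoint U \<in> carrier_mat r N" and cV: "U * (A * mat_adjoint U) \<in> carrier_mat N N"
      using that(1) cU cUa by (auto intro!: mult_carrier_mat)
    have "transpose_mat J * U * A * mat_adjoint U = transpose_mat J * (U * (A * mat_adjoint U))"
      using assoc_mult_mat[OF cJ(2) cU that(1)] assoc_mult_mat[OF cU that(1) cUa]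
        assoc_mult_mat[OF cJ(2) mult_carrier_mat[OF cU that(1)] cUa] by simp
    then show ?thesis
      by (simp only: assoc_mult_mat[OF cJ(2) cV that(2)] assoc_mult_mat[OF cU cAU that(2)]
          assoc_mult_mat[OF that(1) cUa that(2)])
  qed
  have DM': "DM = transpose_mat J * U * Mh * mat_adjoint U" and DK': "DK = transpose_mat J * U * Kh * mat_adjoint U"
    by (simp_all only: DM DK J_def)
  have cDM: "DM \<in> carrier_mat N N" "DK \<in> carrier_mat N N"
    unfolding DM' DK' using cJ cU cUa Mh Kh by (auto intro!: mult_carrier_mat)
  have JD: "J * (transpose_mat J * U * A * mat_adjoint U) = U * A * mat_adjoint U"
    if "A \<in> carrier_mat r r" for A
  proof -
    have "J * (transpose_mat J * U * A * mat_adjoint U) = J * (transpose_mat J * (U * A * mat_adjoint U))"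
      using that cJ cU cUa by (simp add: assoc_mult_mat[of _ N N _ r _ N] assoc_mult_mat[of _ N N _ r _ r])
    also have "\<dots> = J * transpose_mat J * (U * A * mat_adjoint U)"
      using that cJ cU cUa by (intro assoc_mult_mat[symmetric, of _ N N _ N _ N]) auto
    finally show ?thesis
      using JJ left_mult_one_mat[OF mult_carrier_mat[OF mult_carrier_mat[OF cU that] cUa]] by simp
  qed
  have UAU: "mat_adjoint (U * A * mat_adjoint U) = U * mat_adjoint A * mat_adjoint U"
    if "A \<in> carrier_mat r r" for A
    using that cU cUa mat_adjoint_mult[of "U * A" N r "mat_adjoint U" N] mat_adjoint_mult[OF cU that]
    by (simp add: assoc_mult_mat[of _ N r _ r _ N])
  show "star_skew_Hamiltonian n DM"
    using cDM JD[OF Mh(1)] UAU[OF Mh(1)] Mh cU cUa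
    unfolding star_skew_Hamiltonian_def DM'[symmetric] J_def[symmetric] N_def[symmetric] by simp
  show "star_Hamiltonian n DK"
    using cDM JD[OF Kh(1)] UAU[OF Kh(1)] Kh
    unfolding star_Hamiltonian_def DK'[symmetric] J_def[symmetric] N_def[symmetric] by simp
  have "DM * Xf = 0\<^sub>m N q" "DK * Xf = 0\<^sub>m N q"
    unfolding DM' DK' DX[OF Mh(1) cX(2)] DX[OF Kh(1) cX(2)] UXf using cJ cU Mh Kh by auto
  then have f: "(M + DM) * Xf * Lf + (K + DK) * Xf = 0\<^sub>m N q"
    using eqf cX cM cK cDM by (simp add: add_mult_distrib_mat[of _ N N _ _ q])
  have DMX: "DM * Xc = transpose_mat J * (U * Mh)" "DK * Xc = transpose_mat J * (U * Kh)"
    unfolding DM' DK' DX[OF Mh(1) cX(1)] DX[OF Kh(1) cX(1)] UXc using Mh Kh by auto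
  have "DM * Xc * D + DK * Xc = transpose_mat J * (U * (Mh * D + Kh))"
    unfolding DMX using Mh Kh D cU cJ
    by (simp add: mult_add_distrib_mat[of _ N r _ r] mult_add_distrib_mat[of _ N N _ r]
        assoc_mult_mat[of _ N N _ r _ r] assoc_mult_mat[of _ N r _ r _ r])
  also have "\<dots> = transpose_mat J * (S * Xc * (L - D))"
    unfolding hat L_def[symmetric] UG[symmetric] using cU cG D by (simp add: assoc_mult_mat[of _ N r _ r _ r] minus_carrier_mat)
  also have "\<dots> = transpose_mat J * J * (M * Xc * (L - D))"
    unfolding S_def using cJ cM cX D
    by (simp add: assoc_mult_mat[of _ N N _ N _ r] assoc_mult_mat[of _ N N _ r _ r] minus_carrier_mat)
  also have "\<dots> = M * Xc * L - M * Xc * D"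
    unfolding JJ using cM cX D by (simp add: mult_minus_distrib_mat[of _ N r _ r] minus_carrier_mat)
  finally have pert: "DM * Xc * D + DK * Xc = M * Xc * L - M * Xc * D" .
  have c: "(M + DM) * Xc * D + (K + DK) * Xc = 0\<^sub>m N r"
  proof -
    have "(M + DM) * Xc * D + (K + DK) * Xc = (M * Xc * D + DM * Xc * D) + (K * Xc + DK * Xc)"
      using cM cK cDM cX D by (simp add: add_mult_distrib_mat[of _ N N _ _ r] add_mult_distrib_mat[of _ N r _ _ r])
    also have "\<dots> = M * Xc * L + K * Xc"
    proof (rule eq_matI)
      fix i j assume "i < dim_row (M * Xc * L + K * Xc)" "j < dim_col (M * Xc * L + K * Xc)"
      then have ij: "i < N" "j < r" using cK cX by auto
      have "(DM * Xc * D + DK * Xc) $$ (i, j) = (M * Xc * L - M * Xc * D) $$ (i, j)"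
        by (simp only: pert)
      then have "(DM * Xc * D) $$ (i, j) + (DK * Xc) $$ (i, j) = (M * Xc * L) $$ (i, j) - (M * Xc * D) $$ (i, j)"
        using ij cM cK cDM cX D by (simp del: index_mult_mat(1) assoc_mult_mat)
      then show "(M * Xc * D + DM * Xc * D + (K * Xc + DK * Xc)) $$ (i, j) = (M * Xc * L + K * Xc) $$ (i, j)"
        using ij cM cK cDM cX D by (simp add: algebra_simps del: index_mult_mat(1) assoc_mult_mat)
    qed (use cM cK cDM cX D in auto)
    finally show ?thesis using eqc by simp
  qed
  show "complementary_deflating_pairs (2 * n) r q (M + DM) (K + DK) Xc D Xf Lf"
    using Dc Df inv c f D
    unfolding complementary_deflating_pairs_def deflating_pair_def N_def[symmetric] by auto
qed

theorem mainTheorem13: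
  fixes n m p q :: nat
    and M K X\<^sub>c X\<^sub>f \<Lambda>\<^sub>c \<Lambda>\<^sub>f \<Lambda>\<^sub>a G U H\<^sub>a Z\<^sub>1 Z\<^sub>2 M_hat K_hat \<Delta>M \<Delta>K :: "complex mat"
    and l\<^sub>c l\<^sub>a \<alpha> \<beta> z\<^sub>1 z\<^sub>2 :: "nat \<Rightarrow> complex"
  assumes SHH: "star_SHH n M K"
    and regular: "regular_pencil M K"
    and mp: "m \<le> p"
    and compl: "complementary_deflating_pairs (2 * n) (m + p) q M K X\<^sub>c \<Lambda>\<^sub>c X\<^sub>f \<Lambda>\<^sub>f"
    and Lambda_c: "\<Lambda>\<^sub>c = eigenvalue_diag m p l\<^sub>c"
    and l_c_re: "\<forall>j\<in>{1..m}. Re (l\<^sub>c j) \<noteq> 0"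
    and l_c_im: "\<forall>k\<in>{m+1..p}. Re (l\<^sub>c k) = 0"
    and Lambda_a: "\<Lambda>\<^sub>a = eigenvalue_diag m p l\<^sub>a"
    and l_a_re: "\<forall>j\<in>{1..m}. Re (l\<^sub>a j) \<noteq> 0"
    and l_a_im: "\<forall>k\<in>{m+1..p}. Re (l\<^sub>a k) = 0"
    and disjoint: "spectrum \<Lambda>\<^sub>c \<inter> spectrum (- mat_adjoint \<Lambda>\<^sub>f) = {}"
    and G: "G = mat_adjoint X\<^sub>c * J_mat n * M * X\<^sub>c"
    and G_nonsing: "invertible_mat G"
    and simple: "\<forall>i\<in>{1..p}. simple_eigenvalue M K (l\<^sub>c i)"
    and U: "U = J_mat n * M * X\<^sub>c * minv G"
    and H_a: "H\<^sub>a = minv (mat_adjoint \<Lambda>\<^sub>a * \<Lambda>\<^sub>a + 1\<^sub>m (m + p))"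
    and M_hat: "M_hat = G * (\<Lambda>\<^sub>c - \<Lambda>\<^sub>a) * H\<^sub>a * mat_adjoint \<Lambda>\<^sub>a
                  + Z\<^sub>1 * (1\<^sub>m (m + p) - \<Lambda>\<^sub>a * H\<^sub>a * mat_adjoint \<Lambda>\<^sub>a)
                  - Z\<^sub>2 * H\<^sub>a * mat_adjoint \<Lambda>\<^sub>a"
    and K_hat: "K_hat = G * (\<Lambda>\<^sub>c - \<Lambda>\<^sub>a) * H\<^sub>a - Z\<^sub>1 * \<Lambda>\<^sub>a * H\<^sub>a + Z\<^sub>2 * (1\<^sub>m (m + p) - H\<^sub>a)"
    and Z_1: "Z\<^sub>1 = paired_diag m p (\<lambda>j. mat_of_rows_list 2 [[0, \<alpha> j], [- cnj (\<alpha> j), 0]]) z\<^sub>1"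
    and Z_2: "Z\<^sub>2 = paired_diag m p (\<lambda>j. mat_of_rows_list 2 [[0, \<beta> j], [cnj (\<beta> j), 0]]) z\<^sub>2"
    and z_1_im: "\<forall>k\<in>{m+1..p}. Re (z\<^sub>1 k) = 0"
    and z_2_real: "\<forall>k\<in>{m+1..p}. z\<^sub>2 k \<in> \<real>"
    and Delta_M: "\<Delta>M = transpose_mat (J_mat n) * U * M_hat * mat_adjoint U"
    and Delta_K: "\<Delta>K = transpose_mat (J_mat n) * U * K_hat * mat_adjoint U"
  shows "complementary_deflating_pairs (2 * n) (m + p) q (M + \<Delta>M) (K + \<Delta>K) X\<^sub>c \<Lambda>\<^sub>a X\<^sub>f \<Lambda>\<^sub>f
         \<and> star_skew_Hamiltonian n \<Delta>M \<and> star_Hamiltonian n \<Delta>K"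
proof -
  let ?r = "m + p" and ?\<mu> = "paired_entries m l\<^sub>c" and ?d = "paired_entries m l\<^sub>a"
  have c: "M \<in> carrier_mat (2 * n) (2 * n)" "K \<in> carrier_mat (2 * n) (2 * n)"
    using SHH by (auto simp: star_SHH_def star_skew_Hamiltonian_def star_Hamiltonian_def)
  have Lc: "\<Lambda>\<^sub>c = mat_diag ?r ?\<mu>" and La: "\<Lambda>\<^sub>a = mat_diag ?r ?d"
    using Lambda_c Lambda_a eigenvalue_diag_eq[OF mp] by auto
  note compl' = compl[unfolded Lc]
  have Z: "Z\<^sub>1 \<in> carrier_mat ?r ?r" "Z\<^sub>2 \<in> carrier_mat ?r ?r" "mat_adjoint Z\<^sub>1 = - Z\<^sub>1" "mat_adjoint Z\<^sub>2 = Z\<^sub>2"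
    unfolding Z_1 Z_2
    using paired_diag_carrier[OF mp] paired_diag_skew_adjoint[OF mp z_1_im] paired_diag_self_adjoint[OF mp z_2_real]
    by auto
  have Z_supp: "j = partner m i"
    if "i < ?r" "j < ?r" "Z\<^sub>1 $$ (i, j) \<noteq> 0 \<or> Z\<^sub>2 $$ (i, j) \<noteq> 0" for i j
    using that(3) unfolding Z_1 Z_2 paired_diag_off_diagonal[OF mp that(1,2)] by presburger
  have cX: "X\<^sub>c \<in> carrier_mat (2 * n) ?r"
    and eqc: "M * X\<^sub>c * mat_diag ?r ?\<mu> + K * X\<^sub>c = 0\<^sub>m (2 * n) ?r"
    using compl' by (auto simp: complementary_deflating_pairs_def deflating_pair_def)
  note gram = deflating_gram_matrix[OF SHH cX eqc G]
  have supp: "?\<mu> j = - cnj (?\<mu> i) \<and> ?d j = - cnj (?d i)"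
    if ij: "i < ?r" "j < ?r" and nz: "G $$ (i, j) \<noteq> 0 \<or> Z\<^sub>1 $$ (i, j) \<noteq> 0 \<or> Z\<^sub>2 $$ (i, j) \<noteq> 0" for i j
  proof -
    have "j = partner m i"
    proof (cases "G $$ (i, j) = 0")
      case True
      then show ?thesis using nz Z_supp[OF ij] by auto
    next
      case False
      then have "?\<mu> j = ?\<mu> (partner m i)"
        using gram(3)[OF ij] paired_entries_partner[OF l_c_im ij(1)] by simp
      then show ?thesis
        using paired_entries_inj[OF c mp compl' simple ij(2) partner_less[OF mp ij(1)]] by simp
    qed
    then show ?thesis
      using paired_entries_partner[OF l_c_im ij(1)] paired_entries_partner[OF l_a_im ij(1)] by simp
  qed
  note hats = hat_matrices[OF gram(1) Z(1,2) gram(2) Z(3,4) supp H_a[unfolded La]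
      M_hat[unfolded Lc La] K_hat[unfolded Lc La]]
  show ?thesis
    using structured_perturbation[OF SHH compl' disjoint[unfolded Lc] G G_nonsing U mat_diag_dim
        hats(1,3,2,4,5) Delta_M Delta_K]
    unfolding La by blast
qed

end
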